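(* Let $N\ge2$. The period $T^{G_3,M}_N$ of the M-type 3-state Grover walk on $C_N$ equals $6$ if $N=3$ and $\infty$ otherwise. The period $T^{G_3,F}_N$ of the F-type 3-state Grover walk on $C_N$ equals $4$ if $N=3$ and $\infty$ otherwise.
   Context: For $N\ge2$, vertices of the cycle $C_N$ are $\mathbb{Z}/N\mathbb{Z}$. The state space of a 3-state walk is $\mathbb{C}^N\otimes\mathbb{C}^3$ with orthonormal basis $|x\rangle\otimes|\leftarrow\rangle,\ |x\rangle\otimes|\cdot\rangle,\ |x\rangle\otimes|\rightarrow\rangle$ ($x\in\mathbb{Z}/N\mathbb{Z}$). The shift $S$ acts by $S(|x\rangle\otimes|\leftarrow\rangle)=|x-1\rangle\otimes|\leftarrow\rangle$, $S(|x\rangle\otimes|\rightarrow\rangle)=|x+1\rangle\otimes|\rightarrow\rangle$, $S(|x\rangle\otimes|\cdot\rangle)=|x\rangle\otimes|\cdot\rangle$ (mod $N$). For a unitary $3\times3$ local coin $A$ (in the ordered basis $(|\leftarrow\rangle,|\cdot\rangle,|\rightarrow\rangle)$) the time-evolution operator is $U=S(I_N\otimes A)$. The M-type Grover walk uses $A^{G_3,M}=\frac13\begin{bmatrix}-1&2&2\\2&-1&2\\2&2&-1\end{bmatrix}$ and the F-type Grover walk uses $A^{G_3,F}=\frac13\begin{bmatrix}2&2&-1\\2&-1&2\\-1&2&2\end{bmatrix}$; the resulting operators are $U^{G_3,M}_N$ and $U^{G_3,F}_N$. The period of a walk with time-evolution operator $U$ is $\inf\{n\ge1:U^n=I\}$,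 or $\infty$ if no such $n$ exists. *)

theory Defs
  imports "Jordan_Normal_Form.Matrix" "HOL-Library.Extended_Nat"
begin

(* Basis state |x> (x) |c> of C^N (x) C^3, x in Z/NZ represented by 0..<N, and
   c = 0 (left), 1 (stay), 2 (right), is indexed by 3*x + c. *)

definition shift_op :: "nat \<Rightarrow> complex mat" where
  "shift_op N = mat (3*N) (3*N) (\<lambda>(i, j).
     let x = j div 3; c = j mod 3;
         y = (if c = 0 then (x + N - 1) mod N else if c = 2 then (x + 1) mod N else x)
     in if i = 3*y + c then 1 else 0)"

definition coin_op :: "nat \<Rightarrow> complex mat \<Rightarrow> complex mat" where
  "coin_op N A = mat (3*N) (3*N) (\<lambda>(i, j).
     if i div 3 = j div 3 then A $$ (i mod 3, j mod 3) else 0)"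

definition time_evol :: "nat \<Rightarrow> complex mat \<Rightarrow> complex mat" where
  "time_evol N A = shift_op N * coin_op N A"

definition grover_M :: "complex mat" where
  "grover_M = mat_of_rows_list 3 [[-1/3, 2/3, 2/3], [2/3, -1/3, 2/3], [2/3, 2/3, -1/3]]"

definition grover_F :: "complex mat" where
  "grover_F = mat_of_rows_list 3 [[2/3, 2/3, -1/3], [2/3, -1/3, 2/3], [-1/3, 2/3, 2/3]]"

definition period :: "complex mat \<Rightarrow> enat" where
  "period U = (if \<exists>n\<ge>1. U ^\<^sub>m n = 1\<^sub>m (dim_row U)
               then enat (LEAST n. n \<ge> 1 \<and> U ^\<^sub>m n = 1\<^sub>m (dim_row U)) else \<infinity>)"

end

(* Write the walk on N-periodic triples of functions as U and let T be the lazy random walk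
   (average over x - 1, x, x + 1), which commutes with U and acts on the Fourier mode of
   w = exp (2 pi i / N) by t = (1 + 2 cos (2 pi / N)) / 3.  The Cayley-Hamilton theorem for the
   symbol of U reads
     M:   T (U - 1) = - (U - 1) (U + 1 + U^-1),
     F: 2 T (U + 1) =   (U + 1) (U + U^-1).
   If U^n = 1, the states all of whose images under powers of U have values in 3^-n Z form a module
   closed under U, U^-1, translations and hence 3 T.  As T = 3 T - 2 T, in both cases T maps the
   image of this module under U - 1 (resp. U + 1) into itself.  So the orbit of a vector of that
   image under T has bounded denominators; it is also bounded since T averages, hence finite.
   Comparing Fourier coefficients, t^a = t^b for some a < b, and |t| < 1 forces t = 0, i.e. N = 3. *)
theory Submission
  imports Defs
begin

section \<open>Quantum walks as dynamics of periodic functions\<close>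

datatype dir = Lft | Stay | Rgt

primrec ix :: "dir \<Rightarrow> nat" where
  "ix Lft = 0" | "ix Stay = 1" | "ix Rgt = 2"

text \<open>Positions range over all integers and periodicity is imposed separately, so that
  neighbours are plain \<open>x + 1\<close> and \<open>x - 1\<close> and translations need no
  reduction mod N.\<close>

type_synonym state = "dir \<Rightarrow> int \<Rightarrow> complex"

definition periodic :: "nat \<Rightarrow> (int \<Rightarrow> complex) \<Rightarrow> bool" where
  "periodic N g \<longleftrightarrow> (\<forall>x. g (x + int N) = g x)"

text \<open>The operator U read backwards: the amplitude in direction \<open>c\<close> at
  \<open>x\<close> is the coin output at the vertex it was shifted from, namely
  \<open>x + 1\<close>, \<open>x\<close>, \<open>x - 1\<close> for \<open>Lft\<close>,
  \<open>Stay\<close>, \<open>Rgt\<close>.\<close>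

definition step :: "complex mat \<Rightarrow> state \<Rightarrow> state" where
  "step A \<psi> = (\<lambda>c x. let y = x + 1 - int (ix c) in
     A $$ (ix c, 0) * \<psi> Lft y + A $$ (ix c, 1) * \<psi> Stay y + A $$ (ix c, 2) * \<psi> Rgt y)"

definition dir_of :: "nat \<Rightarrow> dir" where
  "dir_of k = (if k = 0 then Lft else if k = 1 then Stay else Rgt)"

definition vec_of :: "nat \<Rightarrow> state \<Rightarrow> complex vec" where
  "vec_of N \<psi> = vec (3 * N) (\<lambda>i. \<psi> (dir_of (i mod 3)) (int (i div 3)))"

lemma dir_of_simps [simp]: "dir_of 0 = Lft" "dir_of (Suc 0) = Stay" "dir_of 2 = Rgt"
  by (auto simp: dir_of_def)

lemma div_mod_3 [simp]:
  fixes x :: nat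
  shows "Suc (3 * x) div 3 = x" "Suc (Suc (3 * x)) div 3 = x"
    "Suc (3 * x) mod 3 = 1" "Suc (Suc (3 * x)) mod 3 = 2"
  by presburger+

lemma ix_dir_of [simp]: "k < 3 \<Longrightarrow> ix (dir_of k) = k"
  by (auto simp: dir_of_def)

lemma dir_of_ix [simp]: "dir_of (ix c) = c"
  by (cases c) (auto simp: dir_of_def)

lemma ix_less [simp]: "ix c < 3"
  by (cases c) auto

lemma periodic_add_mult:
  assumes "periodic N g"
  shows "g (x + int N * k) = g x"
proof (induction k rule: int_induct[where k = 0])
  case base
  show ?case by simp
next
  case (step1 i)
  have "g (x + int N * (i + 1)) = g (x + int N * i + int N)"
    by (simp add: algebra_simps)
  then show ?case using assms step1 by (simp add: periodic_def)
next
  case (step2 i)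
  have "g (x + int N * i) = g (x + int N * (i - 1) + int N)"
    by (simp add: algebra_simps)
  then show ?case using assms step2 by (simp add: periodic_def)
qed

lemma periodic_mod: "periodic N g \<Longrightarrow> g (x mod int N) = g x"
  using periodic_add_mult[of N g "x mod int N" "x div int N"] by simp

lemma periodic_eqI:
  assumes "periodic N g" "periodic N h" "N > 0" "\<And>x. x < N \<Longrightarrow> g (int x) = h (int x)"
  shows "g = h"
proof
  fix x
  have "g (x mod int N) = h (x mod int N)"
    using assms(4)[of "nat (x mod int N)"] assms(3) by (simp add: nat_less_iff)
  then show "g x = h x" using assms(1,2) by (simp add: periodic_mod)
qed

lemma periodic_translate:
  assumes "periodic N g"
  shows "periodic N (\<lambda>x. g (x + k))"
  unfolding periodic_def
proof
  fix x
  have "g (x + k + int N) = g (x + k)" using assms by (simp add: periodic_def)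
  then show "g (x + int N + k) = g (x + k)" by (simp add: algebra_simps)
qed

lemma periodic_step:
  assumes "\<And>c. periodic N (\<psi> c)"
  shows "periodic N (step A \<psi> c)"
  using periodic_translate[OF assms, of _ "1 - int (ix c)"]
  by (simp add: periodic_def step_def Let_def add_diff_eq)

lemma periodic_funpow_step:
  "(\<And>c. periodic N (\<psi> c)) \<Longrightarrow> periodic N ((step A ^^ n) \<psi> c)"
  by (induction n arbitrary: c) (auto intro: periodic_step)

section \<open>Coin and shift matrices acting on coordinate vectors\<close>

lemma sum_lessThan_mult_3:
  fixes f :: "nat \<Rightarrow> 'a::comm_monoid_add"
  shows "sum f {..<3 * N} = (\<Sum>x<N. f (3*x) + f (3*x+1) + f (3*x+2))"
  by (induction N) (simp_all add: numeral_3_eq_3 add.assoc)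

text \<open>The coin matrix is block diagonal: row \<open>i\<close> only meets the three coordinates
  of its own vertex \<open>i div 3\<close>.\<close>

lemma coin_op_vec_of:
  assumes "A \<in> carrier_mat 3 3"
  shows "coin_op N A *\<^sub>v vec_of N \<psi> = vec_of N (\<lambda>c x.
     A $$ (ix c, 0) * \<psi> Lft x + A $$ (ix c, 1) * \<psi> Stay x + A $$ (ix c, 2) * \<psi> Rgt x)"
  (is "_ = vec_of N ?\<phi>")
proof (rule eq_vecI)
  fix i assume "i < dim_vec (vec_of N ?\<phi>)"
  then have i: "i < 3 * N" by (simp add: vec_of_def)
  define g where "g j = (if i div 3 = j div 3 then A $$ (i mod 3, j mod 3) else 0) *
      \<psi> (dir_of (j mod 3)) (int (j div 3))" for j
  have "(coin_op N A *\<^sub>v vec_of N \<psi>) $ i = (\<Sum>j<3*N. g j)"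
    using i by (simp add: coin_op_def vec_of_def scalar_prod_def g_def lessThan_atLeast0)
  also have "\<dots> = (\<Sum>x<N. g (3*x) + g (3*x+1) + g (3*x+2))"
    by (rule sum_lessThan_mult_3)
  also have "\<dots> = (\<Sum>x<N. if x = i div 3 then g (3*x) + g (3*x+1) + g (3*x+2) else 0)"
    by (rule sum.cong) (auto simp: g_def)
  also have "\<dots> = g (3*(i div 3)) + g (3*(i div 3)+1) + g (3*(i div 3)+2)"
    using i by (subst sum.delta) auto
  also have "\<dots> = vec_of N ?\<phi> $ i"
    using i by (simp add: vec_of_def g_def)
  finally show "(coin_op N A *\<^sub>v vec_of N \<psi>) $ i = vec_of N ?\<phi> $ i" .
qed (simp add: coin_op_def vec_of_def)

text \<open>The shift is a permutation matrix, so each row has a single 1, in the column of the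
  basis state that is moved there.\<close>

lemma shift_op_vec_of:
  assumes "N > 0" and per: "\<And>c. periodic N (\<psi> c)"
  shows "shift_op N *\<^sub>v vec_of N \<psi> = vec_of N (\<lambda>c x. \<psi> c (x + 1 - int (ix c)))"
  (is "_ = vec_of N ?\<phi>")
proof (rule eq_vecI)
  fix i assume "i < dim_vec (vec_of N ?\<phi>)"
  then have i: "i < 3 * N" by (simp add: vec_of_def)
  define x c where "x = i div 3" and "c = dir_of (i mod 3)"
  have ic: "i = 3 * x + ix c" "x < N" using i by (auto simp: x_def c_def)
  \<comment> \<open>The vertex from which direction \<open>c\<close> leads to \<open>x\<close>,
    inverting the move in \<open>shift_op\<close>; adding \<open>N\<close> avoids truncated
    subtraction at 0.\<close>
  define y where "y = (if c = Lft then (x + 1) mod N else if c = Rgt then (x + N - 1) mod N else x)"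
  have y: "y < N" using assms ic by (simp add: y_def)
  have inv: "(if k = 0 then (z + N - 1) mod N else if k = 2 then (z + 1) mod N else z) = x
      \<longleftrightarrow> z = y" if "z < N" "k = ix c" for z k
    using that ic assms(1)
    by (cases c) (auto simp: y_def mod_if)
  have S: "shift_op N $$ (i, j) = (if j = 3 * y + ix c then 1 else 0)" if j: "j < 3 * N" for j
  proof -
    define z k where "z = j div 3" and "k = j mod 3"
    have jz: "j = 3 * z + k" "z < N" "k < 3" using j by (auto simp: z_def k_def)
    have "shift_op N $$ (i, j) =
       (if i = 3 * (if k = 0 then (z + N - 1) mod N else if k = 2 then (z + 1) mod N else z) + k
        then 1 else 0)"
      using i j by (simp add: shift_op_def Let_def z_def k_def)
    moreover have div_mod_unique: "(3 * a + b = 3 * a' + b') = (a = a' \<and> b = b')" if "b < 3" "b' < 3" for a b a' b' :: nat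
      using that by presburger
    ultimately have "shift_op N $$ (i, j) = (if x = (if k = 0 then (z + N - 1) mod N
        else if k = 2 then (z + 1) mod N else z) \<and> ix c = k then 1 else 0)"
      unfolding ic(1) using jz(3) by simp
    also have "\<dots> = (if z = y \<and> ix c = k then 1 else 0)"
      using inv[OF jz(2), of k] by (intro if_cong) auto
    also have "\<dots> = (if j = 3 * y + ix c then 1 else 0)"
      using div_mod_unique jz(3) ix_less[of c] unfolding jz(1) by (intro if_cong) auto
    finally show ?thesis .
  qed
  have yc: "3 * y + ix c < 3 * N" using y ix_less[of c] by linarith
  have "(shift_op N *\<^sub>v vec_of N \<psi>) $ i = (\<Sum>j<3*N. shift_op N $$ (i,j) * vec_of N \<psi> $ j)"
    using i by (simp add: shift_op_def vec_of_def scalar_prod_def lessThan_atLeast0)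
  also have "\<dots> = (\<Sum>j<3*N. if j = 3 * y + ix c then vec_of N \<psi> $ j else 0)"
    by (rule sum.cong) (auto simp: S)
  also have "\<dots> = vec_of N \<psi> $ (3 * y + ix c)"
    using yc by (subst sum.delta) auto
  also have "\<dots> = \<psi> c (int y)"
    using yc by (simp add: vec_of_def)
  also have "int y = (int x + 1 - int (ix c)) mod int N"
    using ic assms(1) mod_add_self1[of "int N" "int x - 1"]
    by (cases c) (auto simp: y_def zmod_int of_nat_diff algebra_simps)
  also have "\<psi> c \<dots> = \<psi> c (int x + 1 - int (ix c))"
    using per by (simp add: periodic_mod)
  also have "\<dots> = vec_of N ?\<phi> $ i"
    using i by (simp add: vec_of_def x_def c_def)
  finally show "(shift_op N *\<^sub>v vec_of N \<psi>) $ i = vec_of N ?\<phi> $ i" .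
qed (simp add: shift_op_def vec_of_def)

lemma time_evol_carrier [simp]: "time_evol N A \<in> carrier_mat (3 * N) (3 * N)"
  unfolding time_evol_def by (rule mult_carrier_mat[of _ _ "3 * N"]) (simp_all add: shift_op_def coin_op_def)

lemma vec_of_carrier [simp]: "vec_of N \<psi> \<in> carrier_vec (3 * N)"
  by (simp add: vec_of_def)

lemma time_evol_vec_of:
  assumes "A \<in> carrier_mat 3 3" "N > 0" "\<And>c. periodic N (\<psi> c)"
  shows "time_evol N A *\<^sub>v vec_of N \<psi> = vec_of N (step A \<psi>)"
proof -
  let ?\<phi> = "\<lambda>c x. A $$ (ix c, 0) * \<psi> Lft x + A $$ (ix c, 1) * \<psi> Stay x + A $$ (ix c, 2) * \<psi> Rgt x"
  have "time_evol N A *\<^sub>v vec_of N \<psi> = shift_op N *\<^sub>v (coin_op N A *\<^sub>v vec_of N \<psi>)"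
    unfolding time_evol_def
    by (rule assoc_mult_mat_vec[of _ "3*N" "3*N" _ "3*N"]) (simp_all add: shift_op_def coin_op_def)
  also have "\<dots> = shift_op N *\<^sub>v vec_of N ?\<phi>"
    by (simp add: coin_op_vec_of[OF assms(1)])
  also have "\<dots> = vec_of N (\<lambda>c x. ?\<phi> c (x + 1 - int (ix c)))"
    using assms(2,3) by (intro shift_op_vec_of) (auto simp: periodic_def)
  finally show ?thesis by (simp add: step_def Let_def)
qed

lemma time_evol_pow_vec_of:
  assumes "A \<in> carrier_mat 3 3" "N > 0" "\<And>c. periodic N (\<psi> c)"
  shows "(time_evol N A ^\<^sub>m n) *\<^sub>v vec_of N \<psi> = vec_of N ((step A ^^ n) \<psi>)"
  using assms(3)
\<comment> \<open>The state must vary: the matrix power unfolds as U^n * U, so the induction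
  hypothesis is needed at \<open>step A \<psi>\<close>.\<close>
proof (induction n arbitrary: \<psi>)
  case 0
  then show ?case using vec_of_carrier[of N \<psi>] by (simp del: vec_of_carrier add: time_evol_def shift_op_def)
next
  case (Suc n)
  have "(time_evol N A ^\<^sub>m Suc n) *\<^sub>v vec_of N \<psi> =
      (time_evol N A ^\<^sub>m n) *\<^sub>v (time_evol N A *\<^sub>v vec_of N \<psi>)"
    by (simp, rule assoc_mult_mat_vec[of _ "3*N" "3*N" _ "3*N"]) (auto intro: pow_carrier_mat)
  also have "\<dots> = vec_of N ((step A ^^ n) (step A \<psi>))"
    using assms(1,2) Suc by (simp add: time_evol_vec_of periodic_step)
  finally show ?case by (simp add: funpow_swap1)
qed

section \<open>The equation U^n = 1 in terms of periodic functions\<close>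

lemma vec_of_inject:
  assumes "vec_of N \<phi> = vec_of N \<psi>" "N > 0" "\<And>c. periodic N (\<phi> c)" "\<And>c. periodic N (\<psi> c)"
  shows "\<phi> = \<psi>"
proof
  fix c
  show "\<phi> c = \<psi> c"
  proof (rule periodic_eqI[OF assms(3,4,2)])
    fix x assume "x < N"
    then have "3 * x + ix c < 3 * N" using ix_less[of c] by linarith
    moreover have "vec_of N \<phi> $ (3 * x + ix c) = vec_of N \<psi> $ (3 * x + ix c)"
      using assms(1) by simp
    ultimately show "\<phi> c (int x) = \<psi> c (int x)"
      by (simp add: vec_of_def)
  qed
qed

lemma vec_of_surj:
  assumes "v \<in> carrier_vec (3 * N)" "N > 0"
  obtains \<psi> where "vec_of N \<psi> = v" "\<And>c. periodic N (\<psi> c)"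
proof
  let ?\<psi> = "\<lambda>c x. v $ (3 * nat (x mod int N) + ix c)"
  show "vec_of N ?\<psi> = v"
    using assms by (intro eq_vecI) (auto simp: vec_of_def zmod_int[symmetric])
  show "periodic N (?\<psi> c)" for c by (simp add: periodic_def)
qed

text \<open>A square matrix is the identity iff it fixes all vectors, and \<open>vec_of\<close> is a
  bijection from periodic states onto vectors. After this only iterates of \<open>step\<close> need
  study.\<close>

lemma time_evol_pow_eq_one_iff:
  assumes "A \<in> carrier_mat 3 3" "N > 0"
  shows "time_evol N A ^\<^sub>m n = 1\<^sub>m (dim_row (time_evol N A)) \<longleftrightarrow>
    (\<forall>\<psi>. (\<forall>c. periodic N (\<psi> c)) \<longrightarrow> (step A ^^ n) \<psi> = \<psi>)" (is "?L \<longleftrightarrow> ?R")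
proof -
  let ?U = "time_evol N A"
  have dim: "dim_row ?U = 3 * N" "dim_col ?U = 3 * N"
    using time_evol_carrier by (blast dest: carrier_matD)+
  have car: "?U ^\<^sub>m n \<in> carrier_mat (3 * N) (3 * N)" by (auto intro: pow_carrier_mat)
  show ?thesis
  proof
    assume L: ?L
    show ?R
    proof (intro allI impI)
      fix \<psi> :: state assume per: "\<forall>c. periodic N (\<psi> c)"
      have "vec_of N ((step A ^^ n) \<psi>) = vec_of N \<psi>"
        using time_evol_pow_vec_of[OF assms, of \<psi> n] per L vec_of_carrier[of N \<psi>]
        by (simp add: dim del: vec_of_carrier)
      then show "(step A ^^ n) \<psi> = \<psi>"
        using assms(2) per by (auto intro: vec_of_inject periodic_funpow_step)
    qed
  next
    assume R: ?R
    have "?U ^\<^sub>m n *\<^sub>v v = v" if v: "v \<in> carrier_vec (3 * N)" for v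
    proof -
      obtain \<psi> where "vec_of N \<psi> = v" "\<And>c. periodic N (\<psi> c)"
        using vec_of_surj[OF v assms(2)] by blast
      then show ?thesis using R time_evol_pow_vec_of[OF assms, of \<psi> n] by auto
    qed
    moreover define M where "M = ?U ^\<^sub>m n"
    ultimately have *: "M *\<^sub>v unit_vec (3 * N) j = unit_vec (3 * N) j" for j
      by simp
    have car: "M \<in> carrier_mat (3 * N) (3 * N)" using car by (simp add: M_def)
    have "M = 1\<^sub>m (3 * N)"
    proof (rule eq_matI)
      fix i j assume "i < dim_row (1\<^sub>m (3 * N) :: complex mat)" "j < dim_col (1\<^sub>m (3 * N) :: complex mat)"
      then show "M $$ (i, j) = 1\<^sub>m (3 * N) $$ (i, j)"
        using arg_cong[OF *[of j], of "\<lambda>v. v $ i"] carrier_matD[OF car] by auto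
    qed (use car in auto)
    then show ?L by (simp add: dim M_def)
  qed
qed

section \<open>The lazy random walk and integrality\<close>

definition avg :: "(int \<Rightarrow> complex) \<Rightarrow> int \<Rightarrow> complex" where
  "avg g = (\<lambda>x. (g (x - 1) + g x + g (x + 1)) / 3)"

lemma step_add:
  "step A (\<lambda>c x. \<phi> c x + \<psi> c x) = (\<lambda>c x. step A \<phi> c x + step A \<psi> c x)"
  by (simp add: fun_eq_iff step_def Let_def algebra_simps)

lemma step_uminus: "step A (\<lambda>c x. - \<psi> c x) = (\<lambda>c x. - step A \<psi> c x)"
  by (simp add: fun_eq_iff step_def Let_def algebra_simps)

lemma step_translate: "step A (\<lambda>c x. \<psi> c (x + k)) = (\<lambda>c x. step A \<psi> c (x + k))"
  by (simp add: fun_eq_iff step_def Let_def algebra_simps)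

lemma funpow_step_add:
  "(step A ^^ j) (\<lambda>c x. \<phi> c x + \<psi> c x) =
    (\<lambda>c x. (step A ^^ j) \<phi> c x + (step A ^^ j) \<psi> c x)"
  by (induction j) (simp_all add: step_add)

lemma funpow_step_uminus:
  "(step A ^^ j) (\<lambda>c x. - \<psi> c x) = (\<lambda>c x. - (step A ^^ j) \<psi> c x)"
  by (induction j) (simp_all add: step_uminus)

lemma funpow_step_translate:
  "(step A ^^ j) (\<lambda>c x. \<psi> c (x + k)) = (\<lambda>c x. (step A ^^ j) \<psi> c (x + k))"
  by (induction j) (simp_all add: step_translate)

text \<open>The exponent \<open>n\<close> is a candidate period: powers of the walk beyond \<open>n\<close> add no denominators.\<close>

definition integral_state :: "complex mat \<Rightarrow> nat \<Rightarrow> nat \<Rightarrow> state \<Rightarrow> bool" where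
  "integral_state A N n \<psi> \<longleftrightarrow>
     (\<forall>c. periodic N (\<psi> c)) \<and> (\<forall>j c x. 3 ^ n * (step A ^^ j) \<psi> c x \<in> \<int>)"

lemma integral_state_add: "integral_state A N n \<phi> \<Longrightarrow> integral_state A N n \<psi> \<Longrightarrow>
    integral_state A N n (\<lambda>c x. \<phi> c x + \<psi> c x)"
  by (auto simp: integral_state_def periodic_def funpow_step_add algebra_simps)

lemma integral_state_uminus: "integral_state A N n \<psi> \<Longrightarrow> integral_state A N n (\<lambda>c x. - \<psi> c x)"
  by (auto simp: integral_state_def periodic_def funpow_step_uminus)

lemma integral_state_translate: "integral_state A N n \<psi> \<Longrightarrow> integral_state A N n (\<lambda>c x. \<psi> c (x + k))"
  by (simp add: integral_state_def periodic_translate funpow_step_translate)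

lemma integral_state_funpow_step:
  assumes "integral_state A N n \<psi>"
  shows "integral_state A N n ((step A ^^ k) \<psi>)"
proof -
  have "(step A ^^ j) ((step A ^^ k) \<psi>) = (step A ^^ (j + k)) \<psi>" for j
    by (simp add: funpow_add)
  then show ?thesis using assms by (auto simp: integral_state_def intro: periodic_funpow_step)
qed

lemma integral_state_step: "integral_state A N n \<psi> \<Longrightarrow> integral_state A N n (step A \<psi>)"
  using integral_state_funpow_step[of A N n \<psi> 1] by simp

text \<open>Each step costs at most one factor 3 in the denominators, as the coin has entries in
  (1/3)Z. Since U^n fixes \<psi>, only the exponents \<open>j mod n\<close> matter, so
  \<open>3 ^ n\<close> clears the whole orbit.\<close>

lemma integral_state_of_Ints:
  assumes int: "\<And>i j. i < 3 \<Longrightarrow> j < 3 \<Longrightarrow> 3 * A $$ (i, j) \<in> \<int>"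
    and per: "(step A ^^ n) \<psi> = \<psi>" and "n \<ge> 1" and N: "\<And>c. periodic N (\<psi> c)"
    and \<psi>: "\<And>c x. \<psi> c x \<in> \<int>"
  shows "integral_state A N n \<psi>"
proof -
  have *: "3 ^ j * (step A ^^ j) \<psi> c x \<in> \<int>" for j c x
  proof (induction j arbitrary: c x)
    case 0
    then show ?case using \<psi> by simp
  next
    case (Suc j)
    have "3 ^ Suc j * (step A ^^ Suc j) \<psi> c x = (let y = x + 1 - int (ix c) in
      (3 * A $$ (ix c, 0)) * (3 ^ j * (step A ^^ j) \<psi> Lft y) +
      (3 * A $$ (ix c, 1)) * (3 ^ j * (step A ^^ j) \<psi> Stay y) +
      (3 * A $$ (ix c, 2)) * (3 ^ j * (step A ^^ j) \<psi> Rgt y))"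
      by (simp add: step_def Let_def algebra_simps)
    also have "\<dots> \<in> \<int>"
      unfolding Let_def by (intro Ints_add Ints_mult[OF int Suc]) auto
    finally show ?case .
  qed
  have "3 ^ n * (step A ^^ j) \<psi> c x \<in> \<int>" for j c x
  proof -
    have "j mod n \<le> n" using \<open>n \<ge> 1\<close> by (simp add: less_imp_le)
    then have "(3::complex) ^ n = 3 ^ (n - j mod n) * 3 ^ (j mod n)"
      by (simp flip: power_add)
    moreover have "(step A ^^ j) \<psi> = (step A ^^ (j mod n)) \<psi>"
      using per by (simp add: funpow_mod_eq)
    ultimately have "3 ^ n * (step A ^^ j) \<psi> c x
        = 3 ^ (n - j mod n) * (3 ^ (j mod n) * (step A ^^ (j mod n)) \<psi> c x)"
      by (simp only: mult.assoc)
    also have "\<dots> \<in> \<int>" by (intro Ints_mult[OF _ *] Ints_power) auto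
    finally show ?thesis .
  qed
  then show ?thesis using N by (simp add: integral_state_def)
qed

text \<open>The values are fractions k / 3^n with |k| bounded, hence finitely many, and a periodic
  function is determined by its values on \<open>0..<N\<close>.\<close>

lemma finite_bounded_integral_periodic:
  assumes "N > 0"
  shows "finite {g. periodic N g \<and> (\<forall>x. 3 ^ n * g x \<in> \<int> \<and> cmod (g x) \<le> B)}"
proof -
  define K where "K = \<lceil>3 ^ n * B\<rceil>"
  let ?V = "(\<lambda>k. of_int k / 3 ^ n :: complex) ` {-K..K}"
  have "{g. periodic N g \<and> (\<forall>x. 3 ^ n * g x \<in> \<int> \<and> cmod (g x) \<le> B)}
      \<subseteq> (\<lambda>h x. h (x mod int N)) ` ({0..<int N} \<rightarrow>\<^sub>E ?V)"
  proof safe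
    fix g assume g: "periodic N g" and int: "\<forall>x. 3 ^ n * g x \<in> \<int> \<and> cmod (g x) \<le> B"
    have V: "g x \<in> ?V" for x
    proof -
      obtain k where k: "3 ^ n * g x = of_int k" using int by (auto elim: Ints_cases)
      then have "\<bar>real_of_int k\<bar> = 3 ^ n * cmod (g x)"
        by (metis norm_mult norm_of_int norm_power norm_numeral)
      also have "\<dots> \<le> 3 ^ n * B" using int by simp
      finally have "k \<in> {-K..K}" unfolding K_def by (auto, linarith+)
      moreover have "g x = of_int k / 3 ^ n" using k by (simp add: field_simps)
      ultimately show ?thesis by blast
    qed
    have "g = (\<lambda>x. restrict g {0..<int N} (x mod int N))"
      using assms g by (auto simp: periodic_mod)
    then show "g \<in> (\<lambda>h x. h (x mod int N)) ` ({0..<int N} \<rightarrow>\<^sub>E ?V)"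
      using V by (auto intro!: image_eqI[of _ _ "restrict g {0..<int N}"])
  qed
  then show ?thesis
    by (rule finite_subset) (intro finite_imageI finite_PiE, auto)
qed

section \<open>Fourier modes\<close>

text \<open>Unnormalised Fourier coefficient when w^N = 1. With integer exponents,
  \<open>w powi x * g x\<close> is itself a periodic function on the integers.\<close>

definition fourier :: "nat \<Rightarrow> complex \<Rightarrow> (int \<Rightarrow> complex) \<Rightarrow> complex" where
  "fourier N w g = (\<Sum>x<N. w powi int x * g (int x))"

text \<open>Both sums arise from the sum over 0, ..., N by dropping an end term, and the two end
  terms agree.\<close>

lemma sum_periodic_shift:
  assumes "periodic N g"
  shows "(\<Sum>x<N. g (int x + 1)) = (\<Sum>x<N. g (int x))"
proof -
  have "(\<Sum>x<N. g (int x + 1)) + g 0 = (\<Sum>x<Suc N. g (int x))"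
    by (subst sum.lessThan_Suc_shift) (simp add: add.commute)
  moreover have "g (int N) = g 0" using assms by (metis periodic_def add_0)
  ultimately show ?thesis by simp
qed

lemma fourier_shift:
  assumes "periodic N g" "w ^ N = 1" "w \<noteq> 0"
  shows "fourier N w (\<lambda>x. g (x + 1)) = fourier N w g / w"
proof -
  let ?h = "\<lambda>x. w powi x * g x"
  have "periodic N ?h"
    using assms by (simp add: periodic_def power_int_add)
  from sum_periodic_shift[OF this]
  have "w * fourier N w (\<lambda>x. g (x + 1)) = fourier N w g"
    using assms(3) by (simp add: fourier_def sum_distrib_left power_int_add mult_ac)
  then show ?thesis using assms(3) by (simp add: field_simps)
qed

text \<open>Translations act on the coefficient by the scalars w and 1/w, so averaging acts by the
  mean of w, 1 and 1/w.\<close>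

lemma fourier_avg:
  assumes "periodic N g" "w ^ N = 1" "w \<noteq> 0"
  shows "fourier N w (avg g) = (w + 1 + 1 / w) / 3 * fourier N w g"
proof -
  have "periodic N (\<lambda>x. g (x - 1))"
    using periodic_translate[OF assms(1), of "- 1"] by simp
  from fourier_shift[OF this assms(2,3)]
  have "fourier N w (\<lambda>x. g (x - 1)) = w * fourier N w g"
    using assms(3) by (simp add: field_simps)
  moreover have "fourier N w (avg g) =
      (fourier N w (\<lambda>x. g (x - 1)) + fourier N w g + fourier N w (\<lambda>x. g (x + 1))) / 3"
    by (simp add: fourier_def avg_def sum_divide_distrib flip: sum.distrib)
       (simp add: field_simps)
  ultimately show ?thesis
    using assms by (simp add: fourier_shift field_simps)
qed

lemma periodic_avg: "periodic N g \<Longrightarrow> periodic N (avg g)"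
  using periodic_translate[of N g 1] periodic_translate[of N g "- 1"]
  by (simp add: periodic_def avg_def)

lemma cmod_avg_le:
  assumes "\<And>x. cmod (g x) \<le> B"
  shows "cmod (avg g x) \<le> B"
proof -
  have "cmod (g (x - 1) + g x + g (x + 1)) \<le> B + B + B"
    by (intro order.trans[OF norm_triangle_ineq] add_mono assms)
  then show ?thesis by (simp add: avg_def norm_divide)
qed

section \<open>Finite order forces N = 3\<close>

lemma lazy_walk_eigenvalue_powers_eq:
  fixes N :: nat and t :: real
  assumes N: "N \<ge> 2" and t: "t = (1 + 2 * cos (2 * pi / N)) / 3" and "t ^ a = t ^ b" "a < b"
  shows "N = 3"
proof -
  let ?\<theta> = "2 * pi / N"
  \<comment> \<open>N \<ge> 2 places the angle in (0, pi], where the cosine is injective and below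
    1.\<close>
  have \<theta>: "0 < ?\<theta>" "?\<theta> \<le> pi" using N by (auto simp: field_simps)
  then have "cos ?\<theta> < 1" using cos_monotone_0_pi[of 0 ?\<theta>] by simp
  moreover have t3: "3 * t = 1 + 2 * cos ?\<theta>" using t by simp
  ultimately have "t < 1" "t > -1" using cos_ge_minus_one[of ?\<theta>] by linarith+
  then have "\<bar>t\<bar> < 1" by simp
  \<comment> \<open>For nonzero t with |t| < 1 the powers of |t| decrease strictly, so no two of
    them agree.\<close>
  have "t = 0"
  proof (rule ccontr)
    assume "t \<noteq> 0"
    then have "\<bar>t\<bar> ^ b < \<bar>t\<bar> ^ a"
      using \<open>\<bar>t\<bar> < 1\<close> \<open>a < b\<close> by (intro power_strict_decreasing) auto
    then show False using assms(3) by (simp flip: power_abs)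
  qed
  then have "cos ?\<theta> = cos (2 * pi / 3)" using t3 unfolding cos_120 by simp
  then have "?\<theta> = 2 * pi / 3" 
    using \<theta> by (intro cos_inj_pi[of ?\<theta> "2 * pi / 3"]) simp_all
  then have "pi * real N = pi * 3" using N by (simp add: field_simps)
  then show ?thesis by (simp only: mult_cancel_left pi_neq_zero) simp
qed

text \<open>Common argument for both walks, with s = -1 for M and s = 1 for F. The premise named
  \<open>avg\<close> says that averaging maps the image of the integral states under U + s into
  itself; the orbit of a point mass in that image is then finite and must repeat.\<close>

lemma finite_order_imp_three:
  assumes N: "N \<ge> 2" and "n \<ge> 1" and int: "\<And>i j. i < 3 \<Longrightarrow> j < 3 \<Longrightarrow> 3 * A $$ (i, j) \<in> \<int>"
    and nz: "A $$ (0, 1) \<noteq> 0" and s: "s \<in> \<int>"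
    and per: "\<And>\<psi>. (\<And>c. periodic N (\<psi> c)) \<Longrightarrow> (step A ^^ n) \<psi> = \<psi>"
    and avg: "\<And>\<phi>. integral_state A N n \<phi> \<Longrightarrow> \<exists>\<chi>. integral_state A N n \<chi> \<and>
       (\<forall>c. avg (\<lambda>x. step A \<phi> c x + s * \<phi> c x) = (\<lambda>x. step A \<chi> c x + s * \<chi> c x))"
  shows "N = 3"
proof -
  \<comment> \<open>Unit mass at vertex 0 in direction \<open>Stay\<close>: its \<open>Lft\<close>
    part vanishes, so the term with \<open>s\<close> drops out of \<open>g\<close> below, leaving a
    multiple of a point mass.\<close>
  define e :: state where "e = (\<lambda>c x. if c = Stay \<and> x mod int N = 0 then 1 else 0)"
  have e_per: "periodic N (e c)" for c by (simp add: e_def periodic_def)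
  have e: "integral_state A N n e"
    by (rule integral_state_of_Ints[OF int per \<open>n \<ge> 1\<close> e_per]) (simp_all add: e_per, simp add: e_def)
  \<comment> \<open>Averaging acts on each direction separately, so it suffices to follow the
    \<open>Lft\<close> component.\<close>
  define g where "g = (\<lambda>x. step A e Lft x + s * e Lft x)"
  define f where "f m = (avg ^^ m) g" for m
  have f_Suc: "f (Suc m) = avg (f m)" for m by (simp add: f_def)
  have g_eq: "g x = A $$ (0, 1) * e Stay (x + 1)" for x
    by (simp add: g_def step_def e_def)
  have f_latt: "\<exists>\<chi>. integral_state A N n \<chi> \<and> f m = (\<lambda>x. step A \<chi> Lft x + s * \<chi> Lft x)" for m
  proof (induction m)
    case 0
    show ?case using e by (auto simp: f_def g_def)
  next
    case (Suc m)
    then obtain \<chi> where "integral_state A N n \<chi>" "f m = (\<lambda>x. step A \<chi> Lft x + s * \<chi> Lft x)"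
      by blast
    moreover from avg[OF this(1)] obtain \<chi>' where "integral_state A N n \<chi>'"
      "avg (\<lambda>x. step A \<chi> Lft x + s * \<chi> Lft x) = (\<lambda>x. step A \<chi>' Lft x + s * \<chi>' Lft x)"
      by blast
    ultimately show ?case by (intro exI[of _ \<chi>']) (simp add: f_Suc)
  qed
  have f_per: "periodic N (f m)" for m
  proof (induction m)
    case 0
    have "periodic N (e c)" "periodic N (step A e c)" for c using e_per by (auto intro: periodic_step)
    then show ?case by (simp add: f_def g_def periodic_def)
  next
    case (Suc m)
    then show ?case by (simp add: f_Suc periodic_avg)
  qed
  have f_bd: "cmod (f m x) \<le> cmod (A $$ (0, 1))" for m x
  proof (induction m arbitrary: x)
    case 0
    show ?case by (simp add: f_def g_eq e_def)
  next
    case (Suc m)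
    then show ?case unfolding f_Suc by (rule cmod_avg_le)
  qed
  have f_int: "3 ^ n * f m x \<in> \<int>" for m x
  proof -
    obtain \<chi> where \<chi>: "integral_state A N n \<chi>" "f m = (\<lambda>x. step A \<chi> Lft x + s * \<chi> Lft x)"
      using f_latt by blast
    have "3 ^ n * (step A ^^ j) \<chi> Lft x \<in> \<int>" for j using \<chi>(1) by (simp add: integral_state_def)
    from this[of 0] this[of 1] have "3 ^ n * step A \<chi> Lft x + s * (3 ^ n * \<chi> Lft x) \<in> \<int>"
      using s by simp
    then show ?thesis by (simp add: \<chi>(2) algebra_simps)
  qed
  have "range f \<subseteq> {g. periodic N g \<and> (\<forall>x. 3 ^ n * g x \<in> \<int> \<and> cmod (g x) \<le> cmod (A $$ (0, 1)))}"
    using f_per f_bd f_int by auto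
  then have "finite (range f)"
    using finite_bounded_integral_periodic[of N n] N by (auto intro: finite_subset)
  then have "\<not> inj f" using finite_imageD by fastforce
  then obtain a b where ab: "a < b" "f a = f b"
    by (metis injI linorder_neqE_nat)
  define w where "w = cis (2 * pi / N)"
  have w: "w ^ N = 1" "w \<noteq> 0" using N by (auto simp: w_def DeMoivre)
  define t where "t = (1 + 2 * cos (2 * pi / N)) / 3"
  \<comment> \<open>w and 1/w are conjugate, so the eigenvalue is the real number t.\<close>
  have wt: "(w + 1 + 1 / w) / 3 = of_real t"
  proof -
    have "1 / cis \<theta> = cis (- \<theta>)" for \<theta> by (simp add: divide_inverse)
    moreover have "(cis \<theta> + 1 + cis (- \<theta>)) / 3 = of_real ((1 + 2 * cos \<theta>) / 3)" for \<theta>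
      by (rule complex_eqI) simp_all
    ultimately show ?thesis by (simp only: w_def t_def)
  qed
  have four: "fourier N w (f m) = of_real t ^ m * fourier N w g" for m
  proof (induction m)
    case (Suc m)
    then show ?case using fourier_avg[OF f_per[of m] w] wt by (simp add: f_Suc)
  qed (simp add: f_def)
  \<comment> \<open>A point mass at 0 has coefficient 1, so \<open>g\<close> has coefficient
    \<open>A $$ (0, 1)\<close> / w. It is nonzero by \<open>nz\<close> and cancels when the
    coefficients of \<open>f a\<close> and \<open>f b\<close> are compared.\<close>
  have "fourier N w (e Stay) = (\<Sum>x<N. if x = 0 then 1 else 0)"
    unfolding fourier_def e_def by (rule sum.cong) (auto simp flip: zmod_int)
  then have "fourier N w (e Stay) = 1" using N by simp
  moreover have "fourier N w g = A $$ (0, 1) * fourier N w (\<lambda>x. e Stay (x + 1))"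
    by (simp add: fourier_def g_eq sum_distrib_left mult_ac)
  ultimately have "fourier N w g \<noteq> 0"
    using fourier_shift[OF e_per[of Stay] w] w nz by simp
  then have "complex_of_real t ^ a = of_real t ^ b" using four[of a] four[of b] ab by simp
  then have "t ^ a = t ^ b" by (simp flip: of_real_power)
  then show ?thesis using lazy_walk_eigenvalue_powers_eq[OF N t_def] ab by blast
qed

section \<open>The two Grover walks\<close>

lemma grover_M_carrier [simp]: "grover_M \<in> carrier_mat 3 3"
  by (auto simp: grover_M_def mat_of_rows_list_def)

lemma grover_F_carrier [simp]: "grover_F \<in> carrier_mat 3 3"
  by (auto simp: grover_F_def mat_of_rows_list_def)

lemma step_M [simp]:
  "step grover_M \<psi> Lft x = (- \<psi> Lft (x + 1) + 2 * \<psi> Stay (x + 1) + 2 * \<psi> Rgt (x + 1)) / 3"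
  "step grover_M \<psi> Stay x = (2 * \<psi> Lft x - \<psi> Stay x + 2 * \<psi> Rgt x) / 3"
  "step grover_M \<psi> Rgt x = (2 * \<psi> Lft (x - 1) + 2 * \<psi> Stay (x - 1) - \<psi> Rgt (x - 1)) / 3"
  by (simp_all add: step_def grover_M_def mat_of_rows_list_def Let_def field_simps)

lemma step_F [simp]:
  "step grover_F \<psi> Lft x = (2 * \<psi> Lft (x + 1) + 2 * \<psi> Stay (x + 1) - \<psi> Rgt (x + 1)) / 3"
  "step grover_F \<psi> Stay x = (2 * \<psi> Lft x - \<psi> Stay x + 2 * \<psi> Rgt x) / 3"
  "step grover_F \<psi> Rgt x = (- \<psi> Lft (x - 1) + 2 * \<psi> Stay (x - 1) + 2 * \<psi> Rgt (x - 1)) / 3"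
  by (simp_all add: step_def grover_F_def mat_of_rows_list_def Let_def field_simps)

lemma integral_coins:
  assumes "i < 3" "j < 3"
  shows "3 * grover_M $$ (i, j) \<in> \<int>" "3 * grover_F $$ (i, j) \<in> \<int>"
  using assms by (auto simp: grover_M_def grover_F_def mat_of_rows_list_def numeral_3_eq_3 less_Suc_eq)

text \<open>Stated without inverses; apply them to \<open>\<eta> = U\<^sup>-\<^sup>1 \<phi>\<close>.\<close>

lemma cayley_hamilton_M:
  "avg (\<lambda>x. step grover_M (step grover_M \<eta>) c x - step grover_M \<eta> c x) x =
     \<eta> c x - step grover_M (step grover_M (step grover_M \<eta>)) c x"
  by (cases c) (simp_all add: avg_def field_simps)

lemma cayley_hamilton_F:
  "2 * avg (\<lambda>x. step grover_F (step grover_F \<eta>) c x + step grover_F \<eta> c x) x =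
     step grover_F (step grover_F (step grover_F \<eta>)) c x + step grover_F (step grover_F \<eta>) c x
     + step grover_F \<eta> c x + \<eta> c x"
  by (cases c) (simp_all add: avg_def field_simps)

lemma period_eq_inftyI:
  assumes "\<And>n. n \<ge> 1 \<Longrightarrow> U ^\<^sub>m n \<noteq> 1\<^sub>m (dim_row U)"
  shows "period U = \<infinity>"
  using assms by (auto simp: period_def)

lemma period_eqI:
  assumes "n \<ge> 1" "U ^\<^sub>m n = 1\<^sub>m (dim_row U)"
    and "\<And>m. 1 \<le> m \<Longrightarrow> m < n \<Longrightarrow> U ^\<^sub>m m \<noteq> 1\<^sub>m (dim_row U)"
  shows "period U = enat n"
proof -
  have "(LEAST n. n \<ge> 1 \<and> U ^\<^sub>m n = 1\<^sub>m (dim_row U)) = n"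
    using assms by (intro Least_equality) (auto simp: not_less[symmetric])
  then show ?thesis using assms(1,2) by (auto simp: period_def)
qed

text \<open>By \<open>cayley_hamilton_M\<close>, T (U - 1) \<phi> = (U - 1) \<chi> for \<chi> = - (U
  + 1 + U^-1) \<phi>, where T is \<open>avg\<close>; this \<chi> is again integral.\<close>

lemma grover_M_finite_imp_three:
  assumes "N \<ge> 2" "n \<ge> 1"
    and per: "\<And>\<psi>. (\<And>c. periodic N (\<psi> c)) \<Longrightarrow> (step grover_M ^^ n) \<psi> = \<psi>"
  shows "N = 3"
proof (rule finite_order_imp_three[OF assms(1,2) integral_coins(1) _ _ per, where s = "-1"])
  fix \<phi> assume \<phi>: "integral_state grover_M N n \<phi>"
  \<comment> \<open>Since U^n = 1, this is U^-1 \<phi>; being a forward iterate, it is still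
    integral.\<close>
  define \<eta> where "\<eta> = (step grover_M ^^ (n - 1)) \<phi>"
  have "step grover_M \<eta> = (step grover_M ^^ n) \<phi>"
    using \<open>n \<ge> 1\<close> by (cases n) (simp_all add: \<eta>_def)
  then have \<eta>: "step grover_M \<eta> = \<phi>" using per \<phi> by (simp add: integral_state_def)
  define \<chi> where "\<chi> = (\<lambda>c x. - ((step grover_M \<phi> c x + \<phi> c x) + \<eta> c x))"
  have step_\<chi>: "step grover_M \<chi> = (\<lambda>c x. - ((step grover_M (step grover_M \<phi>) c x + step grover_M \<phi> c x) + \<phi> c x))"
    by (simp only: \<chi>_def step_add step_uminus \<eta>)
  have "integral_state grover_M N n \<chi>"
    unfolding \<chi>_def \<eta>_def using \<phi>
    by (intro integral_state_uminus integral_state_add integral_state_step integral_state_funpow_step)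
  moreover have "avg (\<lambda>x. step grover_M \<phi> c x - \<phi> c x) x = step grover_M \<chi> c x - \<chi> c x" for c x
    using cayley_hamilton_M[of \<eta> c x] unfolding \<eta> step_\<chi> by (simp add: \<chi>_def del: step_M)
  ultimately show "\<exists>\<chi>. integral_state grover_M N n \<chi> \<and>
      (\<forall>c. avg (\<lambda>x. step grover_M \<phi> c x + - 1 * \<phi> c x) = (\<lambda>x. step grover_M \<chi> c x + - 1 * \<chi> c x))"
    by (intro exI[of _ \<chi>]) (simp add: fun_eq_iff del: step_M)
qed (simp_all add: grover_M_def mat_of_rows_list_def)

text \<open>\<open>cayley_hamilton_F\<close> controls only 2T, and halving could leave the integral
  states. Writing T = 3T - 2T avoids this, as 3T is a sum of three translations; it gives \<chi> =
  3T \<phi> - (U + U^-1) \<phi>.\<close>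

lemma grover_F_finite_imp_three:
  assumes "N \<ge> 2" "n \<ge> 1"
    and per: "\<And>\<psi>. (\<And>c. periodic N (\<psi> c)) \<Longrightarrow> (step grover_F ^^ n) \<psi> = \<psi>"
  shows "N = 3"
proof (rule finite_order_imp_three[OF assms(1,2) integral_coins(2) _ _ per, where s = 1])
  fix \<phi> assume \<phi>: "integral_state grover_F N n \<phi>"
  define \<eta> where "\<eta> = (step grover_F ^^ (n - 1)) \<phi>"
  have "step grover_F \<eta> = (step grover_F ^^ n) \<phi>"
    using \<open>n \<ge> 1\<close> by (cases n) (simp_all add: \<eta>_def)
  then have \<eta>: "step grover_F \<eta> = \<phi>" using per \<phi> by (simp add: integral_state_def)
  \<comment> \<open>The first three summands are 3T \<phi>. The forms \<open>x + (-1)\<close> and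
    \<open>+ -\<close> match the closure lemmas for translations and signs.\<close>
  define \<chi> where "\<chi> = (\<lambda>c x. ((\<phi> c (x + (-1)) + \<phi> c x) + \<phi> c (x + 1)) + - (step grover_F \<phi> c x + \<eta> c x))"
  have step_\<chi>: "step grover_F \<chi> = (\<lambda>c x. ((step grover_F \<phi> c (x + (-1)) + step grover_F \<phi> c x)
      + step grover_F \<phi> c (x + 1)) + - (step grover_F (step grover_F \<phi>) c x + \<phi> c x))"
    by (simp only: \<chi>_def step_add step_uminus step_translate \<eta>)
  have "integral_state grover_F N n \<chi>"
    unfolding \<chi>_def \<eta>_def using \<phi>
    by (intro integral_state_uminus integral_state_add integral_state_step
        integral_state_funpow_step integral_state_translate)
  moreover have "avg (\<lambda>x. step grover_F \<phi> c x + \<phi> c x) x = step grover_F \<chi> c x + \<chi> c x" for c x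
    using cayley_hamilton_F[of \<eta> c x] unfolding \<eta> step_\<chi> avg_def
    by (simp add: \<chi>_def field_simps del: step_F)
  ultimately show "\<exists>\<chi>. integral_state grover_F N n \<chi> \<and>
      (\<forall>c. avg (\<lambda>x. step grover_F \<phi> c x + 1 * \<phi> c x) = (\<lambda>x. step grover_F \<chi> c x + 1 * \<chi> c x))"
    by (intro exI[of _ \<chi>]) (simp add: fun_eq_iff del: step_F)
qed (simp_all add: grover_F_def mat_of_rows_list_def)

section \<open>Exact periods on the 3-cycle\<close>

lemma int_shift:
  fixes x :: int
  shows "x + 1 + 1 = x + 2" "x + 2 + 1 = x + 3" "x + 3 + 1 = x + 4"
    "x - 1 - 1 = x - 2" "x - 2 - 1 = x - 3" "x - 3 - 1 = x - 4"
    "x + 2 - 1 = x + 1" "x + 3 - 1 = x + 2" "x - 2 + 1 = x - 1" "x - 3 + 1 = x - 2"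
  by simp_all

text \<open>Together with \<open>int_shift\<close>, brings all offsets met in at most four steps
  back to -1, 0 or 1, so the claims become linear identities in nine values.\<close>

lemma periodic_3:
  assumes "periodic 3 g"
  shows "g (x + 2) = g (x - 1)" "g (x - 2) = g (x + 1)" "g (x + 3) = g x" "g (x - 3) = g x"
    "g (x + 4) = g (x + 1)" "g (x - 4) = g (x - 1)"
  using periodic_add_mult[OF assms, of "x - 1" 1] periodic_add_mult[OF assms, of "x + 1" "-1"]
    periodic_add_mult[OF assms, of x 1] periodic_add_mult[OF assms, of x "-1"]
    periodic_add_mult[OF assms, of "x + 1" 1] periodic_add_mult[OF assms, of "x - 1" "-1"]
  by (simp_all add: algebra_simps)

text \<open>On the 3-cycle \<open>avg\<close> is the mean over all vertices. U^3 fixes states with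
  mean zero in each direction; on states constant in \<open>x\<close>, U acts as the Grover coin G,
  and G^3 = G.\<close>

lemma step_M_pow_3:
  assumes "\<And>c. periodic 3 (\<psi> c)"
  shows "(step grover_M ^^ 3) \<psi> c x = \<psi> c x + (2 * (avg (\<psi> Lft) x + avg (\<psi> Stay) x
      + avg (\<psi> Rgt) x) - 6 * avg (\<psi> c) x) / 3"
proof -
  note p = periodic_3[OF assms, of _ x]
  have "(step grover_M ^^ 3) \<psi> c x = step grover_M (step grover_M (step grover_M \<psi>)) c x"
    by (simp add: numeral_3_eq_3 del: step_M)
  also have "\<dots> = \<psi> c x + (2 * (avg (\<psi> Lft) x + avg (\<psi> Stay) x
      + avg (\<psi> Rgt) x) - 6 * avg (\<psi> c) x) / 3"
    unfolding avg_def by (cases c; simp add: int_shift p; simp add: field_simps)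
  finally show ?thesis .
qed

text \<open>U^3 is an involution: the identity on the mean-zero part, G on the constant part, and
  G^2 = 1.\<close>

lemma step_M_pow_6:
  assumes per: "\<And>c. periodic 3 (\<psi> c)"
  shows "(step grover_M ^^ 6) \<psi> = \<psi>"
proof (intro ext)
  fix c x
  let ?\<phi> = "(step grover_M ^^ 3) \<psi>"
  note p = periodic_3[OF per, of _ x]
  have "(step grover_M ^^ 6) \<psi> c x = (step grover_M ^^ 3) ?\<phi> c x"
    by (simp flip: comp_apply[of "step grover_M ^^ 3"] funpow_add)
  also have "\<dots> = \<psi> c x"
    unfolding step_M_pow_3[of ?\<phi>, OF periodic_funpow_step[OF per]] avg_def step_M_pow_3[OF per]
    by (simp add: int_shift p; simp add: field_simps)
  finally show "(step grover_M ^^ 6) \<psi> c x = \<psi> c x" .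
qed

text \<open>On nonconstant Fourier modes T = 0, so Cayley-Hamilton gives (U + 1)(U^2 + 1) = 0 and
  U^4 = 1; on constant states U is the coin, whose square is 1. The proof checks this by direct
  expansion.\<close>

lemma step_F_pow_4:
  assumes per: "\<And>c. periodic 3 (\<psi> c)"
  shows "(step grover_F ^^ 4) \<psi> = \<psi>"
proof (intro ext)
  fix c x
  note p = periodic_3[OF per, of _ x]
  have "(step grover_F ^^ 4) \<psi> c x = step grover_F (step grover_F (step grover_F (step grover_F \<psi>))) c x"
    by (simp add: eval_nat_numeral del: step_F)
  also have "\<dots> = \<psi> c x"
    by (cases c; simp add: int_shift p; simp add: field_simps)
  finally show "(step grover_F ^^ 4) \<psi> c x = \<psi> c x" .
qed

text \<open>Witness against smaller exponents: a walker resting at vertex 0, whose amplitude there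
  differs from 1 at every positive time below the claimed periods.\<close>

definition stay_state :: state where
  "stay_state = (\<lambda>c x. if c = Stay \<and> x mod 3 = 0 then 1 else 0)"

lemma periodic_stay_state: "periodic 3 (stay_state c)"
  by (simp add: periodic_def stay_state_def)

lemma step_M_pow_stay_state:
  assumes "1 \<le> m" "m < 6"
  shows "(step grover_M ^^ m) stay_state Stay 0 \<noteq> stay_state Stay 0"
proof -
  have "m \<in> {1, 2, 3, 4, 5}" using assms by auto
  then show ?thesis by (auto simp: eval_nat_numeral stay_state_def field_simps)
qed

lemma step_F_pow_stay_state:
  assumes "1 \<le> m" "m < 4"
  shows "(step grover_F ^^ m) stay_state Stay 0 \<noteq> stay_state Stay 0"
proof -
  have "m \<in> {1, 2, 3}" using assms by auto
  then show ?thesis by (auto simp: eval_nat_numeral stay_state_def field_simps)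
qed

lemma period_grover_M_3: "period (time_evol 3 grover_M) = 6"
proof -
  have "period (time_evol 3 grover_M) = enat 6"
    using step_M_pow_6 step_M_pow_stay_state periodic_stay_state
    by (intro period_eqI) (auto simp: time_evol_pow_eq_one_iff simp del: step_M, metis)
  then show ?thesis by (simp add: numeral_eq_enat)
qed

lemma period_grover_F_3: "period (time_evol 3 grover_F) = 4"
proof -
  have "period (time_evol 3 grover_F) = enat 4"
    using step_F_pow_4 step_F_pow_stay_state periodic_stay_state
    by (intro period_eqI) (auto simp: time_evol_pow_eq_one_iff simp del: step_F, metis)
  then show ?thesis by (simp add: numeral_eq_enat)
qed

theorem theorem6p2:
  fixes N :: nat
  assumes "N \<ge> 2"
  shows "period (time_evol N grover_M) = (if N = 3 then 6 else \<infinity>) \<and>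
         period (time_evol N grover_F) = (if N = 3 then 4 else \<infinity>)"
proof (cases "N = 3")
  case True
  then show ?thesis by (simp add: period_grover_M_3 period_grover_F_3)
next
  case False
  have "N > 0" using assms by simp
  have "period (time_evol N grover_M) = \<infinity>"
    using False grover_M_finite_imp_three[OF assms]
    by (intro period_eq_inftyI) (unfold time_evol_pow_eq_one_iff[OF grover_M_carrier \<open>N > 0\<close>], blast)
  moreover have "period (time_evol N grover_F) = \<infinity>"
    using False grover_F_finite_imp_three[OF assms]
    by (intro period_eq_inftyI) (unfold time_evol_pow_eq_one_iff[OF grover_F_carrier \<open>N > 0\<close>], blast)
  ultimately show ?thesis using False by simp
qed

end
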